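(* Let $n$ be a positive integer and suppose $\lambda=\lambda_n$ and $\lambda_m\neq\lambda_n$ for $m=0,1,\dots,n-1$. Then the general solution of the difference equation $$\widetilde{\sigma}[x(s)]\,\Delta_{-1}\nabla_{0}y(s)+\frac{\widetilde{\tau}[x(s)]}{2}\left[\Delta_{0}y(s)+\nabla_{0}y(s)\right]+\lambda y(s)=0$$ is $$y_{n}(s)=\frac{C}{\rho(s)}\Delta_{-n}^{(n)}\Big[\rho(s)\prod_{j=0}^{n-1}\sigma(s-j)\Big]+\frac{1}{\rho(s)}\Delta_{-n}^{(n)}\left[\rho(s)\prod_{j=0}^{n-1}\sigma(s-j)\int_{N}^{s}\frac{P_{n}[x_{-(n+1)}(t)]}{\rho(t)\prod_{j=0}^{n}\sigma(t-j)}\,d_{\nabla}x_{-n}(t)\right],$$ where $C$ is an arbitrary constant and $P_n(\cdot)$ is an arbitrary polynomial of degree $n$.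
   Context: Lattice: $x(s)$ is either $x(s)=c_1q^s+c_2q^{-s}+c_3$ with $c_1c_2\neq0$ ($q\neq 0,1$, a branch of $q^s$ fixed), or $x(s)=\widetilde c_1s^2+\widetilde c_2s+\widetilde c_3$ with $\widetilde c_1\widetilde c_2\neq0$; $s$ is a complex variable. For an integer $k$ put $x_k(s)=x(s+\frac k2)$. Write $\Delta f(s)=f(s+1)-f(s)$, $\nabla f(s)=f(s)-f(s-1)$, $\Delta_kf(s)=\frac{\Delta f(s)}{\Delta x_k(s)}$, $\nabla_kf(s)=\frac{\nabla f(s)}{\nabla x_k(s)}$, and, for $n\ge1$, $\Delta_k^{(n)}=\Delta_{k+n-1}\cdots\Delta_{k+1}\Delta_k$ (so $\Delta_{-n}^{(n)}=\Delta_{-1}\Delta_{-2}\cdots\Delta_{-n}$). Equation data: $\widetilde\sigma,\widetilde\tau$ are polynomials of degree at most two and one respectively, $\lambda$ is a constant, and $$\sigma(s)=\widetilde\sigma[x(s)]-\tfrac12\widetilde\tau[x(s)]\nabla x_1(s),\qquad \tau(s)=\widetilde\tau[x(s)].$$ The function $\rho$ satisfies the Pearson type equation $\Delta_{-1}[\sigma(s)\rho(s)]=\tau(s)\rho(s)$. For a nonnegative integer $j$ let $\tau_j(s)=\dfrac{\sigma(s+j)-\sigma(s)+\tau(s+j)\nabla x_1(s+j)}{\nabla x_{j+1}(s)}$; then $\Delta_j\tau_j(s)$ is a constant independent of $s$, and for $m\ge0$ one sets $\lambda_m=-\sum_{j=0}^{m-1}\Delta_j\tau_j(s)$ (so $\lambda_0=0$).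 Discrete integral: for a function $g$ and an integer $k$, $\int_N^s g(t)\,d_\nabla x_k(t)=\sum_{t=N}^{s}g(t)\nabla x_k(t)$, the sum running over $t=N,N+1,\dots,s$ with $s\in N+\mathbb Z$, extended to all $s\in N+\mathbb Z$ so that the value at $s=N-1$ is $0$ and $\nabla_k\left[\int_N^sg(t)\,d_\nabla x_k(t)\right]=g(s)$. Solutions are considered as functions of $s\in N+\mathbb Z$. All functions appearing in denominators (such as $\rho$, $\sigma$ and the lattice differences) are assumed nonzero at the points considered. *)

theory Defs
  imports Complex_Main "HOL-Computational_Algebra.Polynomial"
begin

(* The branch of q^s is fixed by choosing w with exp w = q, so that q^s = exp (w * s). *)
definition q_quadratic_lattice :: "(complex \<Rightarrow> complex) \<Rightarrow> bool" where
  "q_quadratic_lattice x \<longleftrightarrow>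
     (\<exists>q w c1 c2 c3. q \<noteq> 0 \<and> q \<noteq> 1 \<and> exp w = q \<and> c1 * c2 \<noteq> 0 \<and>
        x = (\<lambda>s. c1 * exp (w * s) + c2 * exp (- (w * s)) + c3))"

definition quadratic_lattice :: "(complex \<Rightarrow> complex) \<Rightarrow> bool" where
  "quadratic_lattice x \<longleftrightarrow>
     (\<exists>c1 c2 c3. c1 * c2 \<noteq> 0 \<and> x = (\<lambda>s. c1 * s\<^sup>2 + c2 * s + c3))"

definition nonuniform_lattice :: "(complex \<Rightarrow> complex) \<Rightarrow> bool" where
  "nonuniform_lattice x \<longleftrightarrow> q_quadratic_lattice x \<or> quadratic_lattice x"

definition xshift :: "(complex \<Rightarrow> complex) \<Rightarrow> int \<Rightarrow> complex \<Rightarrow> complex" where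
  "xshift x k s = x (s + of_int k / 2)"

definition fdiff :: "(complex \<Rightarrow> complex) \<Rightarrow> complex \<Rightarrow> complex" where
  "fdiff f s = f (s + 1) - f s"

definition bdiff :: "(complex \<Rightarrow> complex) \<Rightarrow> complex \<Rightarrow> complex" where
  "bdiff f s = f s - f (s - 1)"

definition fquot :: "(complex \<Rightarrow> complex) \<Rightarrow> int \<Rightarrow> (complex \<Rightarrow> complex) \<Rightarrow> complex \<Rightarrow> complex" where
  "fquot x k f s = fdiff f s / fdiff (xshift x k) s"

definition bquot :: "(complex \<Rightarrow> complex) \<Rightarrow> int \<Rightarrow> (complex \<Rightarrow> complex) \<Rightarrow> complex \<Rightarrow> complex" where
  "bquot x k f s = bdiff f s / bdiff (xshift x k) s"

(* fquot_iter x k n is the operator Delta_k^(n) = Delta_{k+n-1} ... Delta_{k+1} Delta_k;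
   Delta_k is applied first. *)
primrec fquot_iter ::
    "(complex \<Rightarrow> complex) \<Rightarrow> int \<Rightarrow> nat \<Rightarrow> (complex \<Rightarrow> complex) \<Rightarrow> complex \<Rightarrow> complex" where
  "fquot_iter x k 0 f = f"
| "fquot_iter x k (Suc n) f = fquot x (k + int n) (fquot_iter x k n f)"

definition grid :: "complex \<Rightarrow> complex set" where
  "grid N = {N + of_int m | m. True}"

(* sigma and tau as functions of s; St and Tt are the polynomials written with a tilde. *)
definition sigma_fun ::
    "(complex \<Rightarrow> complex) \<Rightarrow> complex poly \<Rightarrow> complex poly \<Rightarrow> complex \<Rightarrow> complex" where
  "sigma_fun x St Tt s = poly St (x s) - (1/2) * poly Tt (x s) * bdiff (xshift x 1) s"

definition tau_fun :: "(complex \<Rightarrow> complex) \<Rightarrow> complex poly \<Rightarrow> complex \<Rightarrow> complex" where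
  "tau_fun x Tt s = poly Tt (x s)"

definition tau_shift ::
    "(complex \<Rightarrow> complex) \<Rightarrow> complex poly \<Rightarrow> complex poly \<Rightarrow> nat \<Rightarrow> complex \<Rightarrow> complex" where
  "tau_shift x St Tt j s =
     (sigma_fun x St Tt (s + of_nat j) - sigma_fun x St Tt s
        + tau_fun x Tt (s + of_nat j) * bdiff (xshift x 1) (s + of_nat j))
     / bdiff (xshift x (int j + 1)) s"

(* Delta_j tau_j does not depend on the point, so its constant value is read off at the
   base point N of the grid, where all lattice differences involved are nonzero. *)
definition eigenval ::
    "(complex \<Rightarrow> complex) \<Rightarrow> complex poly \<Rightarrow> complex poly \<Rightarrow> complex \<Rightarrow> nat \<Rightarrow> complex" where
  "eigenval x St Tt N m = - (\<Sum>j<m. fquot x (int j) (tau_shift x St Tt j) N)"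

(* For s = N + m with m an integer, floor (Re (s - N)) = m; other s are irrelevant.
   At most one of the two sums is nonempty: the first is the sum over t = N, ..., s, and the
   second extends it to s < N - 1. *)
definition nabla_integral ::
    "(complex \<Rightarrow> complex) \<Rightarrow> int \<Rightarrow> complex \<Rightarrow> (complex \<Rightarrow> complex) \<Rightarrow> complex \<Rightarrow> complex" where
  "nabla_integral x k N g s =
     (let m = \<lfloor>Re (s - N)\<rfloor>; h = (\<lambda>i::int. g (N + of_int i) * bdiff (xshift x k) (N + of_int i))
      in (\<Sum>i\<in>{0..m}. h i) - (\<Sum>i\<in>{m+1..-1}. h i))"

lemma nabla_integral_base: "nabla_integral x k N g (N - 1) = 0"
proof -
  have fl: "\<lfloor>Re (N - 1 - N)\<rfloor> = - 1" by (simp add: floor_eq_iff)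
  show ?thesis unfolding nabla_integral_def Let_def fl by simp
qed

lemma bquot_nabla_integral:
  assumes "s \<in> grid N" and "bdiff (xshift x k) s \<noteq> 0"
  shows "bquot x k (nabla_integral x k N g) s = g s"
proof -
  obtain m :: int where s: "s = N + of_int m"
    using assms(1) by (auto simp: grid_def)
  define h where "h = (\<lambda>i::int. g (N + of_int i) * bdiff (xshift x k) (N + of_int i))"
  have 1: "nabla_integral x k N g s = (\<Sum>i\<in>{0..m}. h i) - (\<Sum>i\<in>{m+1..-1}. h i)"
    by (simp add: nabla_integral_def Let_def s h_def)
  have fl: "\<lfloor>Re (s - 1 - N)\<rfloor> = m - 1"
    by (simp add: s)
  have 2: "nabla_integral x k N g (s - 1) = (\<Sum>i\<in>{0..m-1}. h i) - (\<Sum>i\<in>{m..-1}. h i)"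
    unfolding nabla_integral_def Let_def fl by (simp add: h_def)
  have "nabla_integral x k N g s - nabla_integral x k N g (s - 1) = h m"
  proof (cases "m \<ge> 0")
    case True
    then have "{0..m} = insert m {0..m-1}" by auto
    with True show ?thesis by (simp add: 1 2)
  next
    case False
    then have "{m..-1} = insert m {m+1..-1}" by auto
    with False show ?thesis by (simp add: 1 2)
  qed
  then have "bdiff (nabla_integral x k N g) s = g s * bdiff (xshift x k) s"
    by (simp add: bdiff_def h_def s)
  then show ?thesis
    using assms(2) by (simp add: bquot_def)
qed

end

theory Submission
  imports Defs
begin

text \<open>
Put \<open>\<phi> = \<sigma> + \<tau> \<nabla>x\<^sub>1\<close>. Multiplying the equation by \<open>\<rho>\<close> and using Pearson's equation
\<open>\<sigma>(s+1) \<rho>(s+1) = \<phi>(s) \<rho>(s)\<close> gives the adjoint equation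
\<open>\<Delta>\<^bsub>-1\<^esub> M\<^sub>0 w + \<lambda> w = 0\<close> for \<open>w = \<rho> y\<close> (\<open>self_adjoint_form\<close>), where
\<open>M\<^sub>k v(s) = (\<sigma>(s-k) v(s) - \<phi>(s-1) v(s-1)) / \<nabla>x\<^bsub>-k\<^esub>(s)\<close>.

The operators \<open>M\<^sub>k\<close> commute with difference quotients up to a constant,
\<open>M\<^sub>j \<Delta>\<^bsub>-(j+1)\<^esub> = \<Delta>\<^bsub>-(j+2)\<^esub> M\<^bsub>j+1\<^esub> + K\<^sub>j\<close> with \<open>K\<^sub>j = \<Delta>\<^sub>j \<tau>\<^sub>j\<close> (\<open>weighted_diff_fquot\<close>). Because
\<open>\<lambda>\<^sub>n\<close> is minus the sum of \<open>K\<^sub>j\<close> over \<open>j < n\<close>, the substitution \<open>w = \<Delta>\<^bsub>-n\<^esub>\<^bsup>(n)\<^esup> v\<close> turns the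
adjoint equation for \<open>\<lambda> = \<lambda>\<^sub>n\<close> into \<open>\<Delta>\<^bsub>-(n+1)\<^esub>\<^bsup>(n+1)\<^esup> M\<^sub>n v = 0\<close>
(\<open>adjoint_factorization\<close>). Every \<open>w\<close> on the grid has this form, as difference quotients can be
inverted by summation.

The kernel of \<open>\<Delta>\<^bsub>-(n+1)\<^esub>\<^bsup>(n+1)\<^esup>\<close> consists of the polynomials of degree at most \<open>n\<close> in
\<open>x\<^bsub>-(n+1)\<^esub>\<close> (\<open>fquot_iter_poly_eq_0\<close>, \<open>fquot_iter_eq_0_imp_poly\<close>). One inclusion requires that
the numbers \<open>[d]\<close>, \<open>1 \<le> d \<le> n\<close>, by which differencing multiplies leading coefficients, do not
vanish. If \<open>[d] = 0\<close>, then \<open>q\<close> is a root of unity with \<open>q\<^sup>d = 1\<close> and \<open>\<lambda>\<^bsub>n-d\<^esub> = \<lambda>\<^sub>n\<close>, so the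
assumption on the eigenvalues excludes this. The equation is thereby reduced to the first order
equation \<open>M\<^sub>n v = P\<close>, which the integrating factor \<open>\<rho> \<Prod>\<^bsub>j<n\<^esub> \<sigma>(s-j)\<close> solves by one summation
(\<open>weighted_diff_rodrigues_weight\<close>); this produces the stated formula.

It remains to see that \<open>P\<close> can be taken of degree exactly \<open>n\<close>. The function \<open>v\<close> is determined
by \<open>w\<close> only up to the kernel of \<open>\<Delta>\<^bsub>-n\<^esub>\<^bsup>(n)\<^esup>\<close>, and this kernel contains a \<open>v\<^sub>1\<close> for which \<open>M\<^sub>n v\<^sub>1\<close>
has degree \<open>n\<close>, because \<open>\<lambda>\<^sub>n \<noteq> \<lambda>\<^sub>0 = 0\<close> (\<open>kernel_element_of_full_degree\<close>). Adding a multiple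
of \<open>v\<^sub>1\<close> to \<open>v\<close> adjusts the top coefficient of \<open>P\<close> (\<open>kernel_correction\<close>).
\<close>

section \<open>Midpoint relations of nonuniform lattices\<close>

text \<open>
The numbers \<open>[d]\<close> with \<open>[d+1] + [d-1] = 2 \<alpha> [d]\<close>, that is, the Chebyshev polynomials
\<open>U\<^bsub>d-1\<^esub>(\<alpha>)\<close>. They treat both kinds of lattice at once: \<open>\<alpha> = 1\<close> gives \<open>[d] = d\<close>,
and \<open>\<alpha> = (h + 1/h)/2\<close> with \<open>h\<^sup>2 = q\<close> gives the symmetric \<open>q\<close>-numbers.
\<close>

fun q_number :: "complex \<Rightarrow> nat \<Rightarrow> complex" where
  "q_number \<alpha> 0 = 0"
| "q_number \<alpha> (Suc 0) = 1"
| "q_number \<alpha> (Suc (Suc d)) = 2 * \<alpha> * q_number \<alpha> (Suc d) - q_number \<alpha> d"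

lemma q_number_one: "q_number 1 d = of_nat d"
  by (induction "1::complex" d rule: q_number.induct) (simp_all add: algebra_simps)

lemma q_number_exp:
  assumes "h \<noteq> 0"
  shows "(h - inverse h) * q_number ((h + inverse h) / 2) d = h ^ d - inverse h ^ d"
proof (induction "(h + inverse h) / 2" d rule: q_number.induct)
  case (3 d)
  define k where "k = inverse h"
  have hk: "h * k = 1" using assms by (simp add: k_def)
  have e: "(h - k) * q_number ((h + k) / 2) (Suc (Suc d))
      = (h + k) * ((h - k) * q_number ((h + k) / 2) (Suc d)) - (h - k) * q_number ((h + k) / 2) d"
    by (simp add: field_simps)
  have "\<dots> = (h + k) * (h ^ Suc d - k ^ Suc d) - (h ^ d - k ^ d)"
    using 3 by (simp only: k_def)
  also have "\<dots> = h ^ Suc (Suc d) - k ^ Suc (Suc d)"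
  proof -
    have cancel: "h * (k * z) = z" "k * (h * z) = z" for z
      using hk by (metis mult.assoc mult.commute mult_1)+
    show ?thesis by (simp add: distrib_right right_diff_distrib cancel)
  qed
  finally show ?case using e by (simp add: k_def)
qed simp_all

text \<open>
The coefficient that Pearson's equation pairs with \<open>\<sigma>\<close>: it turns the equation into
\<open>\<sigma>(s+1) \<rho>(s+1) = \<phi>(s) \<rho>(s)\<close>, and \<open>\<sigma>\<close> and \<open>\<phi>\<close> differ only in the sign of
the \<open>\<tau>\<close>-term.
\<close>

definition sigma_dual ::
    "(complex \<Rightarrow> complex) \<Rightarrow> complex poly \<Rightarrow> complex poly \<Rightarrow> complex \<Rightarrow> complex" where
  "sigma_dual x St Tt s = poly St (x s) + (1/2) * poly Tt (x s) * bdiff (xshift x 1) s"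

lemma sigma_dual_eq:
  "sigma_dual x St Tt s = sigma_fun x St Tt s + tau_fun x Tt s * bdiff (xshift x 1) s"
  by (simp add: sigma_dual_def sigma_fun_def tau_fun_def field_simps)

lemma poly_degree_le_2:
  fixes p :: "complex poly"
  assumes "degree p \<le> 2"
  shows "poly p z = coeff p 0 + coeff p 1 * z + coeff p 2 * z\<^sup>2"
  using arg_cong[OF poly_as_sum_of_monoms'[OF assms], of "\<lambda>q. poly q z"]
  by (simp add: poly_sum poly_monom numeral_2_eq_2)

lemma poly_degree_le_1:
  fixes p :: "complex poly"
  assumes "degree p \<le> 1"
  shows "poly p z = coeff p 0 + coeff p 1 * z"
  using arg_cong[OF poly_as_sum_of_monoms'[OF assms], of "\<lambda>q. poly q z"]
  by (simp add: poly_sum poly_monom)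

text \<open>
Written around the midpoint \<open>u = s + j/2\<close>, the difference is odd under the reflection of \<open>u\<close>
that preserves the lattice function \<open>x\<close>: this reflection exchanges \<open>x(u + a)\<close> with \<open>x(u - a)\<close> and
\<open>\<delta>(u + a)\<close> with \<open>- \<delta>(u - a)\<close>. Oddness is what makes the difference divisible by
\<open>x(u + 1/2) - x(u - 1/2)\<close>.
\<close>

lemma dual_difference_centred:
  "sigma_dual x St Tt (s + of_nat j) - sigma_fun x St Tt s =
     (let u = s + of_nat j / 2; a = of_nat j / 2; \<delta> = (\<lambda>u. x (u + 1/2) - x (u - 1/2)) in
       poly St (x (u + a)) - poly St (x (u - a))
         + (1/2) * (poly Tt (x (u + a)) * \<delta> (u + a) + poly Tt (x (u - a)) * \<delta> (u - a)))"
proof -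
  have shift: "s + of_nat j / 2 + of_nat j / 2 = s + of_nat j"
    "s + of_nat j / 2 - of_nat j / 2 = s"
    by (simp_all add: field_simps)
  have diff: "bdiff (xshift x 1) t = x (t + 1/2) - x (t - 1/2)" for t
    by (simp add: bdiff_def xshift_def)
  show ?thesis
    unfolding sigma_dual_def sigma_fun_def Let_def shift diff by (simp add: distrib_left)
qed

lemma bdiff_centred:
  "bdiff (xshift x (int j + 1)) s = x (s + of_nat j / 2 + 1/2) - x (s + of_nat j / 2 - 1/2)"
proof -
  have "s - 1 + of_int (int j + 1) / 2 = s + of_nat j / 2 - 1/2"
    and "s + of_int (int j + 1) / 2 = s + of_nat j / 2 + 1/2"
    by (simp_all add: field_simps)
  then show ?thesis by (simp only: bdiff_def xshift_def)
qed

text \<open>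
Here \<open>x(u + a) - x(u - a)\<close> equals \<open>2a\<close> times \<open>x(u + 1/2) - x(u - 1/2)\<close>, so the quotient
\<open>\<tau>\<^sub>j\<close> is affine in the lattice variable, and its slope \<open>2 j a\<^sub>2 + b\<^sub>1\<close> (with \<open>a\<^sub>2\<close>, \<open>b\<^sub>1\<close>
the leading coefficients of the two polynomials) is affine in \<open>j\<close>.
\<close>

lemma quadratic_lattice_structure:
  assumes x: "x = (\<lambda>s. c1 * s\<^sup>2 + c2 * s + c3)"
    and "degree St \<le> 2" and "degree Tt \<le> 1"
  shows "x (u + 1/2) + x (u - 1/2) = 2 * 1 * x u + c1 / 2"
    and "x (u + 1/2) * x (u - 1/2) = (x u)\<^sup>2 + (- c1 / 2) * x u + (c1 * c3 + c1\<^sup>2 / 16 - c2\<^sup>2 / 4)"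
    and "sigma_dual x St Tt (s + of_nat j) - sigma_fun x St Tt s =
      ((2 * coeff St 2 * of_nat j + coeff Tt 1) * xshift x (int j) s
       + (of_nat j * (coeff St 2 * c1 * (of_nat j)\<^sup>2 / 2 + coeff St 1)
          + coeff Tt 1 * c1 * (of_nat j)\<^sup>2 * (3/4) + coeff Tt 0))
        * bdiff (xshift x (int j + 1)) s"
proof -
  show "x (u + 1/2) + x (u - 1/2) = 2 * 1 * x u + c1 / 2"
    by (simp add: x field_simps power2_eq_square)
  show "x (u + 1/2) * x (u - 1/2) = (x u)\<^sup>2 + (- c1 / 2) * x u + (c1 * c3 + c1\<^sup>2 / 16 - c2\<^sup>2 / 4)"
    by (simp add: x field_simps power2_eq_square)
  define v where "v = s + of_nat j / 2"
  have xv: "xshift x (int j) s = x v" by (simp add: xshift_def v_def)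
  show "sigma_dual x St Tt (s + of_nat j) - sigma_fun x St Tt s =
      ((2 * coeff St 2 * of_nat j + coeff Tt 1) * xshift x (int j) s
       + (of_nat j * (coeff St 2 * c1 * (of_nat j)\<^sup>2 / 2 + coeff St 1)
          + coeff Tt 1 * c1 * (of_nat j)\<^sup>2 * (3/4) + coeff Tt 0))
        * bdiff (xshift x (int j + 1)) s"
    unfolding dual_difference_centred bdiff_centred xv Let_def v_def[symmetric]
      poly_degree_le_2[OF assms(2)] poly_degree_le_1[OF assms(3)]
    unfolding x by (simp add: field_simps power2_eq_square)
qed

text \<open>
With \<open>p = c\<^sub>1 q\<^sup>u\<close> and \<open>m = c\<^sub>2 q\<^bsup>-u\<^esup>\<close> a shift of \<open>u\<close> by \<open>a\<close> multiplies \<open>p\<close> by \<open>q\<^sup>a\<close> and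
\<open>m\<close> by \<open>q\<^bsup>-a\<^esup>\<close>. The midpoint sum and product are then symmetric in \<open>p\<close> and \<open>m\<close>, hence
polynomials in \<open>x = p + m + c\<^sub>3\<close> (as \<open>p m\<close> is constant), and the dual difference is
\<open>p - m\<close> times such a polynomial of degree at most one. The slope of the quotient has the form
\<open>A q\<^sup>j + B q\<^bsup>-j\<^esup>\<close>, which is what later controls coincidences between the eigenvalues.
\<close>

lemma q_quadratic_lattice_structure:
  assumes x: "x = (\<lambda>s. c1 * exp (w * s) + c2 * exp (- (w * s)) + c3)"
    and w: "exp w \<noteq> 1"
    and "degree St \<le> 2" and "degree Tt \<le> 1"
    and h: "h = exp (w / 2)"
  shows "x (u + 1/2) + x (u - 1/2) = 2 * ((h + inverse h) / 2) * x u + (2 - h - inverse h) * c3"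
    and "x (u + 1/2) * x (u - 1/2) =
      (x u)\<^sup>2 + c3 * (h + inverse h - 2) * x u
        + (c3\<^sup>2 * (2 - h - inverse h) + c1 * c2 * (h - inverse h)\<^sup>2)"
    and "\<exists>L. \<forall>s. sigma_dual x St Tt (s + of_nat j) - sigma_fun x St Tt s =
      (((coeff St 2 / (h - inverse h) + coeff Tt 1 / 2) * exp w ^ j
        + (coeff Tt 1 / 2 - coeff St 2 / (h - inverse h)) * inverse (exp w) ^ j)
          * xshift x (int j) s + L) * bdiff (xshift x (int j + 1)) s"
proof -
  define k where "k = inverse h"
  have hk: "h * k = 1" by (simp add: h k_def)
  have k: "k = exp (- (w / 2))" by (simp add: h k_def exp_minus)
  have hh: "h * h = exp w" by (simp add: h flip: exp_add)
  have hnk: "h - k \<noteq> 0"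
    using hh hk w by auto
  have step: "x (t + a) = c1 * (exp (w * t) * exp (w * a)) + c2 * (exp (- (w * t)) * exp (- (w * a))) + c3"
    "x (t - a) = c1 * (exp (w * t) * exp (- (w * a))) + c2 * (exp (- (w * t)) * exp (w * a)) + c3"
    for t a by (simp_all add: x algebra_simps flip: exp_add)
  have half: "x (t + 1/2) = c1 * (exp (w * t) * h) + c2 * (exp (- (w * t)) * k) + c3"
    "x (t - 1/2) = c1 * (exp (w * t) * k) + c2 * (exp (- (w * t)) * h) + c3" for t
    using step[of t "1/2"] by (simp_all add: h k)
  have inv: "exp (w * t) * exp (- (w * t)) = 1" for t by (simp flip: exp_add)
  show "x (u + 1/2) + x (u - 1/2) = 2 * ((h + inverse h) / 2) * x u + (2 - h - inverse h) * c3"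
    unfolding half k_def[symmetric] by (simp add: x field_simps)
  define e f where "e = exp (w * u)" and "f = exp (- (w * u))"
  have "e * f = 1" using inv by (simp add: e_def f_def)
  with hk show "x (u + 1/2) * x (u - 1/2) =
      (x u)\<^sup>2 + c3 * (h + inverse h - 2) * x u
        + (c3\<^sup>2 * (2 - h - inverse h) + c1 * c2 * (h - inverse h)\<^sup>2)"
    unfolding half k_def[symmetric] unfolding x e_def[symmetric] f_def[symmetric] by algebra
  \<comment> \<open>In this part \<open>g = q\<^bsup>j/2\<^esup>\<close> and \<open>l = q\<^bsup>-j/2\<^esup>\<close> are the factors of the shift from the
    midpoint to the two end points, and \<open>h\<close>, \<open>k\<close> those of a shift by one half.\<close>
  define g l where "g = exp (w * (of_nat j / 2))" and "l = exp (- (w * (of_nat j / 2)))"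
  have g2: "exp w ^ j = g\<^sup>2" and l2: "inverse (exp w) ^ j = l\<^sup>2"
    by (simp_all add: g_def l_def power2_eq_square exp_of_nat_mult[symmetric]
          exp_minus[symmetric] mult.commute flip: exp_add)
  define i where "i = 1 / (h - k)"
  have ik: "i * (h - k) = 1" using hnk by (simp add: i_def)
  define a0 a1 a2 b0 b1 where "a0 = coeff St 0" and "a1 = coeff St 1" and "a2 = coeff St 2"
    and "b0 = coeff Tt 0" and "b1 = coeff Tt 1"
  define L where "L = i * (g - l) * (a1 + 2 * a2 * c3 - a2 * (g + l) * c3)
     + (1/2) * (b1 * (c3 * (g + l) - (g\<^sup>2 + l\<^sup>2) * c3) + b0 * (g + l))"
  have "sigma_dual x St Tt (s + of_nat j) - sigma_fun x St Tt s =
      (((a2 * i + b1 / 2) * g\<^sup>2 + (b1 / 2 - a2 * i) * l\<^sup>2)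
          * xshift x (int j) s + L) * bdiff (xshift x (int j + 1)) s" for s
  proof -
    define v where "v = s + of_nat j / 2"
    have xv: "xshift x (int j) s = x v" by (simp add: xshift_def v_def)
    define e f where "e = exp (w * v)" and "f = exp (- (w * v))"
    define p where "p = c1 * e"
    define m where "m = c2 * f"
    have xvv: "x v = p + m + c3" by (simp add: x p_def m_def e_def f_def)
    have xp: "x (v + of_nat j / 2) = p * g + m * l + c3"
      "x (v - of_nat j / 2) = p * l + m * g + c3"
      unfolding step e_def[symmetric] f_def[symmetric] g_def[symmetric] l_def[symmetric]
      by (simp_all add: p_def m_def)
    have e1: "exp (w * (v + of_nat j / 2)) = e * g" "exp (- (w * (v + of_nat j / 2))) = f * l"
      "exp (w * (v - of_nat j / 2)) = e * l" "exp (- (w * (v - of_nat j / 2))) = f * g"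
      unfolding e_def f_def g_def l_def by (simp_all add: algebra_simps flip: exp_add)
    have dp: "x (v + of_nat j / 2 + 1/2) - x (v + of_nat j / 2 - 1/2) = (h - k) * (p * g - m * l)"
      "x (v - of_nat j / 2 + 1/2) - x (v - of_nat j / 2 - 1/2) = (h - k) * (p * l - m * g)"
      "x (v + 1/2) - x (v - 1/2) = (h - k) * (p - m)"
      unfolding half e1 unfolding e_def[symmetric] f_def[symmetric]
      by (simp_all add: p_def m_def algebra_simps)
    have S: "(a0 + a1 * (p * g + m * l + c3) + a2 * (p * g + m * l + c3)\<^sup>2)
        - (a0 + a1 * (p * l + m * g + c3) + a2 * (p * l + m * g + c3)\<^sup>2)
      = (p - m) * (g - l) * (a1 + a2 * ((g + l) * (p + m) + 2 * c3))"
      by algebra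
    have T: "(b0 + b1 * (p * g + m * l + c3)) * (p * g - m * l)
        + (b0 + b1 * (p * l + m * g + c3)) * (p * l - m * g)
      = (p - m) * (b1 * ((g\<^sup>2 + l\<^sup>2) * (p + m) + c3 * (g + l)) + b0 * (g + l))"
      by algebra
    have K: "((a2 * i + b1 / 2) * g\<^sup>2 + (b1 / 2 - a2 * i) * l\<^sup>2) * (p + m + c3) + L =
       i * ((g - l) * (a1 + a2 * ((g + l) * (p + m) + 2 * c3)))
        + (1/2) * (b1 * ((g\<^sup>2 + l\<^sup>2) * (p + m) + c3 * (g + l)) + b0 * (g + l))"
      unfolding L_def by (simp add: field_simps power2_eq_square)
    have goal_pm: "?thesis \<longleftrightarrow> (a0 + a1 * (p * g + m * l + c3) + a2 * (p * g + m * l + c3)\<^sup>2)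
        - (a0 + a1 * (p * l + m * g + c3) + a2 * (p * l + m * g + c3)\<^sup>2)
        + (1/2) * ((b0 + b1 * (p * g + m * l + c3)) * ((h - k) * (p * g - m * l))
          + (b0 + b1 * (p * l + m * g + c3)) * ((h - k) * (p * l - m * g)))
      = (((a2 * i + b1 / 2) * g\<^sup>2 + (b1 / 2 - a2 * i) * l\<^sup>2) * (p + m + c3) + L) * ((h - k) * (p - m))"
      unfolding dual_difference_centred bdiff_centred xv Let_def v_def[symmetric]
        poly_degree_le_2[OF assms(3)] poly_degree_le_1[OF assms(4)] dp xp xvv
      by (simp add: a0_def a1_def a2_def b0_def b1_def)
    have "(b0 + b1 * (p * g + m * l + c3)) * ((h - k) * (p * g - m * l))
        + (b0 + b1 * (p * l + m * g + c3)) * ((h - k) * (p * l - m * g))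
      = (h - k) * ((p - m) * (b1 * ((g\<^sup>2 + l\<^sup>2) * (p + m) + c3 * (g + l)) + b0 * (g + l)))"
      unfolding T[symmetric] by (simp add: algebra_simps)
    moreover have "(p - m) * (g - l) * (a1 + a2 * ((g + l) * (p + m) + 2 * c3)) =
       i * ((g - l) * (a1 + a2 * ((g + l) * (p + m) + 2 * c3))) * ((h - k) * (p - m))"
      using ik by algebra
    moreover have "A + (1/2) * B = (i * G + (1/2) * W) * ((h - k) * (p - m))"
      if "B = (h - k) * ((p - m) * W)" and "A = i * G * ((h - k) * (p - m))" for A B G W
      unfolding that by (simp add: distrib_right)
    ultimately show ?thesis unfolding goal_pm S K by blast
  qed
  then show "\<exists>L. \<forall>s. sigma_dual x St Tt (s + of_nat j) - sigma_fun x St Tt s =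
      (((coeff St 2 / (h - inverse h) + coeff Tt 1 / 2) * exp w ^ j
        + (coeff Tt 1 / 2 - coeff St 2 / (h - inverse h)) * inverse (exp w) ^ j)
          * xshift x (int j) s + L) * bdiff (xshift x (int j + 1)) s"
    by (auto simp: g2 l2 a2_def b1_def i_def k_def)
qed

text \<open>
All that is needed about the lattices. The third property says that \<open>\<tau>\<^sub>j\<close> is an affine function
of \<open>x\<^sub>j\<close>, so that \<open>\<Delta>\<^sub>j \<tau>\<^sub>j\<close> is the constant \<open>K j\<close> and \<open>\<lambda>\<^sub>m\<close> is minus the sum of the first
\<open>m\<close> of these constants. The last property says that \<open>[d] = 0\<close> forces \<open>\<lambda>\<^bsub>m+d\<^esub> = \<lambda>\<^sub>m\<close>:
then \<open>q\<^sup>d = 1\<close>, and \<open>A q\<^sup>j + B q\<^bsup>-j\<^esup>\<close> sums to zero over a full period as \<open>q \<noteq> 1\<close>.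
\<close>

lemma nonuniform_lattice_structure:
  assumes "nonuniform_lattice x" and "degree St \<le> 2" and "degree Tt \<le> 1"
  obtains \<alpha> \<beta> \<gamma> \<delta> :: complex and K L :: "nat \<Rightarrow> complex" where
    "\<And>u. x (u + 1/2) + x (u - 1/2) = 2 * \<alpha> * x u + \<beta>"
    "\<And>u. x (u + 1/2) * x (u - 1/2) = (x u)\<^sup>2 + \<gamma> * x u + \<delta>"
    "\<And>j s. sigma_dual x St Tt (s + of_nat j) - sigma_fun x St Tt s =
      (K j * xshift x (int j) s + L j) * bdiff (xshift x (int j + 1)) s"
    "\<And>d m. d > 0 \<Longrightarrow> q_number \<alpha> d = 0 \<Longrightarrow> (\<Sum>j<m + d. K j) = (\<Sum>j<m. K j)"
proof -
  consider "q_quadratic_lattice x" | "quadratic_lattice x"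
    using assms(1) by (auto simp: nonuniform_lattice_def)
  then show thesis
  proof cases
    case 1
    then obtain w c1 c2 c3 where w: "exp w \<noteq> 1"
      and x: "x = (\<lambda>s. c1 * exp (w * s) + c2 * exp (- (w * s)) + c3)"
      by (auto simp: q_quadratic_lattice_def)
    define h where "h = exp (w / 2)"
    note * = q_quadratic_lattice_structure[OF x w assms(2,3) h_def]
    define A B where "A = coeff St 2 / (h - inverse h) + coeff Tt 1 / 2"
      and "B = coeff Tt 1 / 2 - coeff St 2 / (h - inverse h)"
    obtain L where L: "\<And>j s. sigma_dual x St Tt (s + of_nat j) - sigma_fun x St Tt s =
      ((A * exp w ^ j + B * inverse (exp w) ^ j) * xshift x (int j) s + L j)
        * bdiff (xshift x (int j + 1)) s"
      using *(3) unfolding A_def B_def by metis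
    have hh: "h ^ 2 = exp w" by (simp add: h_def power2_eq_square flip: exp_add)
    show thesis
    proof (rule that[OF *(1,2) L])
      fix d m :: nat
      assume "d > 0" and "q_number ((h + inverse h) / 2) d = 0"
      then have "h ^ d = inverse h ^ d"
        using q_number_exp[of h d] by (simp add: h_def)
      then have "h ^ d * h ^ d = inverse h ^ d * h ^ d" by simp
      also have "\<dots> = 1"
        unfolding power_mult_distrib[symmetric] by (simp add: h_def)
      finally have "h ^ d * h ^ d = 1" .
      then have "exp w ^ d = 1"
        unfolding hh[symmetric] by (simp add: power2_eq_square power_mult_distrib)
      then have eq: "exp w ^ (m + d) = exp w ^ m" "inverse (exp w) ^ (m + d) = inverse (exp w) ^ m"
        by (simp_all add: power_add power_inverse)
      have w': "inverse (exp w) \<noteq> 1" using w by (simp add: inverse_eq_1_iff)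
      show "(\<Sum>j<m + d. A * exp w ^ j + B * inverse (exp w) ^ j)
          = (\<Sum>j<m. A * exp w ^ j + B * inverse (exp w) ^ j)"
        unfolding sum.distrib sum_distrib_left[symmetric]
          geometric_sum[OF w] geometric_sum[OF w'] eq ..
    qed
  next
    case 2
    then obtain c1 c2 c3 where x: "x = (\<lambda>s. c1 * s\<^sup>2 + c2 * s + c3)"
      by (auto simp: quadratic_lattice_def)
    show thesis
      by (rule that[OF quadratic_lattice_structure[OF x assms(2,3)]]) (simp add: q_number_one)
  qed
qed

text \<open>
\<open>(X\<^sup>d - Y\<^sup>d) / (X - Y)\<close> as a polynomial in \<open>z\<close>, when \<open>X + Y = 2 \<alpha> z + \<beta>\<close> and
\<open>X Y = z\<^sup>2 + \<gamma> z + \<delta>\<close>. The recursion is the one satisfied by the complete homogeneous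
polynomials in \<open>X\<close> and \<open>Y\<close>.
\<close>

fun power_diffquot :: "complex \<Rightarrow> complex \<Rightarrow> complex \<Rightarrow> complex \<Rightarrow> nat \<Rightarrow> complex poly" where
  "power_diffquot \<alpha> \<beta> \<gamma> \<delta> 0 = 0"
| "power_diffquot \<alpha> \<beta> \<gamma> \<delta> (Suc 0) = 1"
| "power_diffquot \<alpha> \<beta> \<gamma> \<delta> (Suc (Suc d)) =
     [:\<beta>, 2 * \<alpha>:] * power_diffquot \<alpha> \<beta> \<gamma> \<delta> (Suc d)
       - [:\<delta>, \<gamma>, 1:] * power_diffquot \<alpha> \<beta> \<gamma> \<delta> d"

text \<open>
Only the product term with leading coefficient \<open>1\<close> and the sum term with leading coefficient
\<open>2 \<alpha>\<close> contribute to the top degree, which gives the recursion of \<open>[d]\<close>.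
\<close>

lemma coeff_power_diffquot:
  "i \<ge> d \<Longrightarrow> coeff (power_diffquot \<alpha> \<beta> \<gamma> \<delta> d) i = 0"
  "coeff (power_diffquot \<alpha> \<beta> \<gamma> \<delta> (Suc d)) d = q_number \<alpha> (Suc d)"
proof -
  show "i \<ge> d \<Longrightarrow> coeff (power_diffquot \<alpha> \<beta> \<gamma> \<delta> d) i = 0" for d i
    by (induction \<alpha> \<beta> \<gamma> \<delta> d arbitrary: i rule: power_diffquot.induct)
      (auto simp: coeff_pCons split: nat.split)
  note vanish = this
  show "coeff (power_diffquot \<alpha> \<beta> \<gamma> \<delta> (Suc d)) d = q_number \<alpha> (Suc d)"
  proof (induction d rule: induct_nat_012)
    case (ge2 d)
    have "power_diffquot \<alpha> \<beta> \<gamma> \<delta> (Suc (Suc (Suc d)))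
        = [:\<beta>, 2 * \<alpha>:] * power_diffquot \<alpha> \<beta> \<gamma> \<delta> (Suc (Suc d))
          - [:\<delta>, \<gamma>, 1:] * power_diffquot \<alpha> \<beta> \<gamma> \<delta> (Suc d)"
      by (rule power_diffquot.simps)
    with ge2 show ?case by (simp add: coeff_pCons vanish del: power_diffquot.simps)
  qed (simp_all add: coeff_pCons)
qed

lemma poly_power_diffquot:
  assumes "X + Y = 2 * \<alpha> * z + \<beta>" and "X * Y = z\<^sup>2 + \<gamma> * z + \<delta>"
  shows "X ^ d - Y ^ d = poly (power_diffquot \<alpha> \<beta> \<gamma> \<delta> d) z * (X - Y)"
proof (induction d rule: induct_nat_012)
  case (ge2 d)
  have "poly [:\<beta>, 2 * \<alpha>:] z = X + Y" "poly [:\<delta>, \<gamma>, 1:] z = X * Y"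
    using assms by (simp_all add: algebra_simps power2_eq_square)
  moreover have "X ^ Suc (Suc d) - Y ^ Suc (Suc d) =
      (X + Y) * (X ^ Suc d - Y ^ Suc d) - X * Y * (X ^ d - Y ^ d)"
    by (simp add: algebra_simps)
  ultimately show ?case
    unfolding ge2 power_diffquot.simps poly_diff poly_mult by (simp only: algebra_simps)
qed simp_all

section \<open>Difference quotients on the grid\<close>

lemma grid_base [simp]: "N \<in> grid N"
  by (auto simp: grid_def intro: exI[of _ 0])

lemma grid_closed [simp]:
  assumes "s \<in> grid N"
  shows "s + 1 \<in> grid N" "s - 1 \<in> grid N" "s + of_nat j \<in> grid N" "s - of_nat j \<in> grid N"
proof -
  obtain m where s: "s = N + of_int m" using assms by (auto simp: grid_def)
  have "s + of_int i \<in> grid N" for i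
    using s by (auto simp: grid_def intro!: exI[of _ "m + i"])
  from this[of 1] this[of "-1"] this[of "int j"] this[of "- int j"]
  show "s + 1 \<in> grid N" "s - 1 \<in> grid N" "s + of_nat j \<in> grid N" "s - of_nat j \<in> grid N"
    by simp_all
qed

lemma grid_const:
  assumes "\<And>s. s \<in> grid N \<Longrightarrow> f (s + 1) = f s" and "s \<in> grid N"
  shows "f s = f N"
proof -
  obtain m where s: "s = N + of_int m" using assms(2) by (auto simp: grid_def)
  have on_grid: "N + of_int i \<in> grid N" for i by (auto simp: grid_def)
  have "f (N + of_int m) = f N"
  proof (induction m rule: int_induct[of _ 0])
    case (step1 i)
    then show ?case using assms(1)[OF on_grid[of i]] by (simp add: add.assoc)
  next
    case (step2 i)
    then show ?case using assms(1)[OF on_grid[of "i - 1"]] by (simp add: algebra_simps)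
  qed simp
  then show ?thesis by (simp add: s)
qed

lemma bquot_shift: "bquot x k f (s + 1) = fquot x k f s"
  by (simp add: bquot_def fquot_def bdiff_def fdiff_def)

lemma bdiff_xshift: "bdiff (xshift x (k + 2)) s = fdiff (xshift x k) s"
  by (simp add: bdiff_def fdiff_def xshift_def field_simps)

lemma fquot_cong:
  assumes "\<And>s. s \<in> grid N \<Longrightarrow> f s = g s" and "s \<in> grid N"
  shows "fquot x k f s = fquot x k g s"
  using assms by (simp add: fquot_def fdiff_def)

lemma fquot_iter_cong:
  assumes "\<And>s. s \<in> grid N \<Longrightarrow> f s = g s" and "s \<in> grid N"
  shows "fquot_iter x k m f s = fquot_iter x k m g s"
  using assms(2)
proof (induction m arbitrary: s)
  case (Suc m)
  then show ?case by (auto intro: fquot_cong)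
qed (simp add: assms(1))

text \<open>
Peels off the operator applied first instead of the one applied last; inductions on polynomial
degree and the commutation argument proceed from the inside.
\<close>

lemma fquot_iter_Suc_inner:
  "fquot_iter x k (Suc m) f = fquot_iter x (k + 1) m (fquot x k f)"
  by (induction m) (simp_all add: algebra_simps)

lemma fquot_iter_linear:
  "fquot_iter x k m (\<lambda>t. a * f t + b * g t) s = a * fquot_iter x k m f s + b * fquot_iter x k m g s"
proof (induction m arbitrary: s)
  case (Suc m)
  then have "fquot_iter x k m (\<lambda>t. a * f t + b * g t)
      = (\<lambda>s. a * fquot_iter x k m f s + b * fquot_iter x k m g s)" by blast
  then show ?case by (simp add: fquot_def fdiff_def field_simps add_divide_distrib diff_divide_distrib)
qed simp

text \<open>
A grid on which no lattice difference vanishes, for a lattice whose values at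
\<open>u + 1/2\<close> and \<open>u - 1/2\<close> are the two roots of a quadratic with coefficients polynomial in
\<open>x(u)\<close>. By these midpoint relations \<open>\<Delta>\<^sub>k\<close> maps polynomials in \<open>x\<^sub>k\<close> to polynomials in
\<open>x\<^bsub>k+1\<^esub>\<close>, as \<open>x\<^sub>k(s)\<close> and \<open>x\<^sub>k(s+1)\<close> are neighbours of the midpoint value \<open>x\<^bsub>k+1\<^esub>(s)\<close>.
\<close>

locale lattice_grid =
  fixes x :: "complex \<Rightarrow> complex" and N \<alpha> \<beta> \<gamma> \<delta> :: complex
  assumes fdiff_nz: "s \<in> grid N \<Longrightarrow> fdiff (xshift x k) s \<noteq> 0"
    and midpoint_sum: "x (u + 1/2) + x (u - 1/2) = 2 * \<alpha> * x u + \<beta>"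
    and midpoint_prod: "x (u + 1/2) * x (u - 1/2) = (x u)\<^sup>2 + \<gamma> * x u + \<delta>"
begin

lemma bdiff_nz: "s \<in> grid N \<Longrightarrow> bdiff (xshift x k) s \<noteq> 0"
  using bdiff_xshift[of x "k - 2" s] fdiff_nz[of s "k - 2"] by simp

lemma fquot_antiderivative:
  obtains f where "\<And>s. s \<in> grid N \<Longrightarrow> fquot x k f s = g s"
proof
  fix s assume "s \<in> grid N"
  then show "fquot x k (nabla_integral x k N (\<lambda>t. g (t - 1))) s = g s"
    by (simp add: bquot_shift[symmetric] bquot_nabla_integral bdiff_nz)
qed

lemma bquot_eq_imp_nabla_integral:
  assumes z: "\<And>s. s \<in> grid N \<Longrightarrow> bquot x k z s = g s" and "s \<in> grid N"
  shows "z s = z (N - 1) + nabla_integral x k N g s"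
proof -
  let ?d = "\<lambda>s. z s - nabla_integral x k N g s"
  have "?d (t + 1) = ?d t" if "t \<in> grid N" for t
  proof -
    have "bquot x k z (t + 1) = bquot x k (nabla_integral x k N g) (t + 1)"
      using that z by (simp add: bquot_nabla_integral bdiff_nz)
    then have "bdiff z (t + 1) = bdiff (nabla_integral x k N g) (t + 1)"
      using bdiff_nz[of "t + 1" k] that by (simp add: bquot_def)
    then show ?thesis by (simp add: bdiff_def algebra_simps)
  qed
  then have const: "?d t = ?d N" if "t \<in> grid N" for t
    using grid_const[of N ?d t] that by blast
  have "N - 1 \<in> grid N" by simp
  then have "?d s = ?d (N - 1)"
    using const[of s] const[of "N - 1"] assms(2) by simp
  then show ?thesis by (simp add: nabla_integral_base diff_eq_eq)
qed

lemma fquot_iter_antiderivative: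
  obtains f where "\<And>s. s \<in> grid N \<Longrightarrow> fquot_iter x k m f s = g s"
proof -
  have "\<exists>f. \<forall>s\<in>grid N. fquot_iter x k m f s = g s"
  proof (induction m arbitrary: g)
    case 0
    show ?case by auto
  next
    case (Suc m)
    obtain g' where g': "\<And>s. s \<in> grid N \<Longrightarrow> fquot x (k + int m) g' s = g s"
      using fquot_antiderivative by blast
    from Suc[of g'] obtain f where "\<And>s. s \<in> grid N \<Longrightarrow> fquot_iter x k m f s = g' s" by blast
    then have "fquot_iter x k (Suc m) f s = g s" if "s \<in> grid N" for s
      using fquot_cong[of N "fquot_iter x k m f" g' s] g' that by simp
    then show ?case by blast
  qed
  then show thesis using that by blast
qed

section \<open>The kernel of the iterated difference quotient\<close>

lemma fquot_power:
  assumes "s \<in> grid N"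
  shows "fquot x k (\<lambda>t. xshift x k t ^ d) s
      = poly (power_diffquot \<alpha> \<beta> \<gamma> \<delta> d) (xshift x (k + 1) s)"
proof -
  define u where "u = s + of_int (k + 1) / 2"
  have "s + of_int k / 2 = u - 1/2" "s + 1 + of_int k / 2 = u + 1/2"
    by (simp_all add: u_def field_simps)
  then have "xshift x k s = x (u - 1/2)" "xshift x k (s + 1) = x (u + 1/2)" "xshift x (k + 1) s = x u"
    by (simp_all only: xshift_def u_def)
  then show ?thesis
    using fdiff_nz[OF assms, of k] poly_power_diffquot[OF midpoint_sum midpoint_prod, of u d]
    by (simp add: fquot_def fdiff_def)
qed

lemma fquot_poly:
  assumes P: "\<And>i. i > m \<Longrightarrow> coeff P i = 0"
  obtains Q where "\<And>i. i \<ge> m \<Longrightarrow> coeff Q i = 0"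
    and "\<And>s. s \<in> grid N \<Longrightarrow> fquot x k (\<lambda>t. poly P (xshift x k t)) s = poly Q (xshift x (k + 1) s)"
proof
  define Q where "Q = (\<Sum>d\<le>m. smult (coeff P d) (power_diffquot \<alpha> \<beta> \<gamma> \<delta> d))"
  show "coeff Q i = 0" if "i \<ge> m" for i
    using that by (simp add: Q_def coeff_sum coeff_power_diffquot(1))
  have "poly P z = (\<Sum>d\<le>m. coeff P d * z ^ d)" for z
  proof -
    have "degree P \<le> m" using P by (simp add: degree_le)
    from arg_cong[OF poly_as_sum_of_monoms'[OF this], of "\<lambda>p. poly p z"] show ?thesis
      by (simp add: poly_sum poly_monom)
  qed
  then show "fquot x k (\<lambda>t. poly P (xshift x k t)) s = poly Q (xshift x (k + 1) s)"
    if "s \<in> grid N" for s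
    unfolding Q_def
    by (simp add: poly_sum flip: fquot_power[OF that])
      (simp add: fquot_def fdiff_def right_diff_distrib
        flip: sum_subtractf sum_divide_distrib)
qed

lemma fquot_iter_poly_eq_0:
  assumes "\<And>i. i \<ge> m \<Longrightarrow> coeff P i = 0" and "s \<in> grid N"
  shows "fquot_iter x k m (\<lambda>t. poly P (xshift x k t)) s = 0"
  using assms
proof (induction m arbitrary: k P s)
  case 0
  then have "P = 0" by (simp add: poly_eqI)
  then show ?case by simp
next
  case (Suc m)
  then obtain Q where Q: "\<And>i. i \<ge> m \<Longrightarrow> coeff Q i = 0"
    and PQ: "\<And>s. s \<in> grid N \<Longrightarrow> fquot x k (\<lambda>t. poly P (xshift x k t)) s = poly Q (xshift x (k + 1) s)"
    using fquot_poly[of m P k] by (metis Suc_leI)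
  show ?case
    unfolding fquot_iter_Suc_inner
    using fquot_iter_cong[OF PQ Suc.prems(2)] Suc.IH[OF Q Suc.prems(2)] by simp
qed

text \<open>
Since \<open>\<Delta>\<^sub>k\<close> sends the monomial of degree \<open>d\<close> to a polynomial with leading term
\<open>[d] x\<^bsub>k+1\<^esub>\<^bsup>d-1\<^esup>\<close>, the top coefficient can be removed as long as \<open>[d]\<close> is nonzero.
\<close>

lemma poly_antiderivative:
  assumes "\<And>d. 0 < d \<Longrightarrow> d \<le> m \<Longrightarrow> q_number \<alpha> d \<noteq> 0"
    and "\<And>i. i \<ge> m \<Longrightarrow> coeff Q i = 0"
  shows "\<exists>P. (\<forall>i>m. coeff P i = 0) \<and>
      (\<forall>s\<in>grid N. fquot x k (\<lambda>t. poly P (xshift x k t)) s = poly Q (xshift x (k + 1) s))"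
  using assms
proof (induction m arbitrary: Q)
  case 0
  then have "Q = 0" by (simp add: poly_eqI)
  then show ?case by (intro exI[of _ 0]) (simp add: fquot_def fdiff_def)
next
  case (Suc m)
  define c where "c = coeff Q m / q_number \<alpha> (Suc m)"
  define D where "D = power_diffquot \<alpha> \<beta> \<gamma> \<delta> (Suc m)"
  have c: "c * q_number \<alpha> (Suc m) = coeff Q m" using Suc.prems(1)[of "Suc m"] by (simp add: c_def)
  have "coeff (Q - smult c D) i = 0" if "i \<ge> m" for i
  proof (cases "i = m")
    case True
    then show ?thesis using c by (simp add: D_def coeff_power_diffquot(2))
  next
    case False
    with that show ?thesis using Suc.prems(2)[of i] by (simp add: D_def coeff_power_diffquot(1))
  qed
  with Suc.IH[of "Q - smult c D"] Suc.prems(1) obtain P where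
    P: "\<And>i. i > m \<Longrightarrow> coeff P i = 0" and
    dP: "\<And>s. s \<in> grid N \<Longrightarrow> fquot x k (\<lambda>t. poly P (xshift x k t)) s
      = poly (Q - smult c D) (xshift x (k + 1) s)"
    by (metis le_SucI)
  show ?case
  proof (intro exI[of _ "P + monom c (Suc m)"] conjI allI impI ballI)
    show "coeff (P + monom c (Suc m)) i = 0" if "i > Suc m" for i
      using that P[of i] by simp
    fix s assume s: "s \<in> grid N"
    have "fquot x k (\<lambda>t. poly (P + monom c (Suc m)) (xshift x k t)) s
        = fquot x k (\<lambda>t. poly P (xshift x k t)) s + c * fquot x k (\<lambda>t. xshift x k t ^ Suc m) s"
      by (simp add: poly_monom fquot_def fdiff_def add_divide_distrib diff_divide_distrib right_diff_distrib)
    then show "fquot x k (\<lambda>t. poly (P + monom c (Suc m)) (xshift x k t)) s = poly Q (xshift x (k + 1) s)"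
      unfolding dP[OF s] fquot_power[OF s] D_def[symmetric] by simp
  qed
qed

text \<open>
Without the condition on \<open>[d]\<close> the claim fails, for instance, on a lattice with \<open>q = -1\<close>: there
\<open>x\<^sub>k\<close> takes only two values on the grid, so that polynomials in \<open>x\<^sub>k\<close> span a space of dimension at
most two, while the kernel of \<open>\<Delta>\<^sub>k\<^bsup>(m)\<^esup>\<close> has dimension \<open>m\<close>.
\<close>

lemma fquot_iter_eq_0_imp_poly:
  assumes "\<And>d. 0 < d \<Longrightarrow> d < m \<Longrightarrow> q_number \<alpha> d \<noteq> 0"
    and "\<And>s. s \<in> grid N \<Longrightarrow> fquot_iter x k m f s = 0"
  shows "\<exists>P. (\<forall>i\<ge>m. coeff P i = 0) \<and> (\<forall>s\<in>grid N. f s = poly P (xshift x k s))"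
  using assms
proof (induction m arbitrary: k f)
  case 0
  then show ?case by (intro exI[of _ 0]) simp
next
  case (Suc m)
  have "\<exists>Q. (\<forall>i\<ge>m. coeff Q i = 0) \<and> (\<forall>s\<in>grid N. fquot x k f s = poly Q (xshift x (k + 1) s))"
    by (rule Suc.IH) (use Suc.prems in \<open>auto simp: fquot_iter_Suc_inner simp del: fquot_iter.simps\<close>)
  then obtain Q where Q: "\<And>i. i \<ge> m \<Longrightarrow> coeff Q i = 0"
    and fQ: "\<And>s. s \<in> grid N \<Longrightarrow> fquot x k f s = poly Q (xshift x (k + 1) s)"
    by blast
  obtain P where P: "\<And>i. i > m \<Longrightarrow> coeff P i = 0"
    and PQ: "\<And>s. s \<in> grid N \<Longrightarrow> fquot x k (\<lambda>t. poly P (xshift x k t)) s = poly Q (xshift x (k + 1) s)"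
    using poly_antiderivative[of m Q k] Suc.prems(1) Q by (metis less_Suc_eq_le)
  define g where "g = (\<lambda>s. f s - poly P (xshift x k s))"
  have "g (s + 1) = g s" if "s \<in> grid N" for s
  proof -
    have "fquot x k f s = fquot x k (\<lambda>t. poly P (xshift x k t)) s"
      using fQ[OF that] PQ[OF that] by simp
    then have "fdiff f s = fdiff (\<lambda>t. poly P (xshift x k t)) s"
      using fdiff_nz[OF that, of k] by (simp add: fquot_def)
    then show ?thesis by (simp add: g_def fdiff_def algebra_simps)
  qed
  then have g: "g s = g N" if "s \<in> grid N" for s
    using that by (rule grid_const)
  show ?case
  proof (intro exI[of _ "P + [:g N:]"] conjI allI impI ballI)
    show "coeff (P + [:g N:]) i = 0" if "i \<ge> Suc m" for i
      using that P[of i] by (simp add: coeff_pCons split: nat.split)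
    show "f s = poly (P + [:g N:]) (xshift x k s)" if "s \<in> grid N" for s
      using g[OF that] by (simp add: g_def algebra_simps)
  qed
qed

end

section \<open>The first order operators and their commutation rule\<close>

text \<open>
The first order operators \<open>M\<^sub>k v = (\<sigma>(s-k) v(s) - \<phi>(s-1) v(s-1)) / \<nabla>x\<^bsub>-k\<^esub>(s)\<close>.
They are discrete analogues of \<open>v \<mapsto> \<sigma> v' - (\<tau> + (k-1) \<sigma>') v\<close>, which is the operator
\<open>\<sigma>\<^bsup>k+1\<^esup> \<rho> (v / (\<rho> \<sigma>\<^sup>k))'\<close>.
\<close>

definition weighted_diff ::
    "(complex \<Rightarrow> complex) \<Rightarrow> (complex \<Rightarrow> complex) \<Rightarrow> (complex \<Rightarrow> complex) \<Rightarrow> nat \<Rightarrow>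
      (complex \<Rightarrow> complex) \<Rightarrow> complex \<Rightarrow> complex" where
  "weighted_diff x \<sigma> \<phi> k v s =
     (\<sigma> (s - of_nat k) * v s - \<phi> (s - 1) * v (s - 1)) / bdiff (xshift x (- int k)) s"

lemma weighted_diff_cong:
  assumes "\<And>s. s \<in> grid N \<Longrightarrow> f s = g s" and "s \<in> grid N"
  shows "weighted_diff x \<sigma> \<phi> k f s = weighted_diff x \<sigma> \<phi> k g s"
  using assms by (simp add: weighted_diff_def)

lemma weighted_diff_linear:
  "weighted_diff x \<sigma> \<phi> k (\<lambda>t. a * f t + b * g t) s
     = a * weighted_diff x \<sigma> \<phi> k f s + b * weighted_diff x \<sigma> \<phi> k g s"
  by (simp add: weighted_diff_def add_divide_distrib diff_divide_distrib algebra_simps)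

context lattice_grid
begin

text \<open>
The discrete form of \<open>M\<^bsub>k-1\<^esub> v' = (M\<^sub>k v)' + (\<tau>' + (k-1) \<sigma>'') v\<close>, with \<open>k = j + 1\<close>. On both sides
the coefficients of \<open>v(s+1)\<close> and \<open>v(s-1)\<close> agree; the coefficients of \<open>v(s)\<close> differ by
the difference quotient of \<open>\<tau>\<^sub>j\<close>, which is the constant \<open>K\<close>.
\<close>

lemma weighted_diff_fquot:
  assumes K: "\<And>s. s \<in> grid N \<Longrightarrow>
      \<phi> (s + of_nat j) - \<sigma> s = (K * xshift x (int j) s + L) * bdiff (xshift x (int j + 1)) s"
    and s: "s \<in> grid N"
  shows "weighted_diff x \<sigma> \<phi> j (fquot x (- int (Suc j)) v) s
    = fquot x (- int (Suc j) - 1) (weighted_diff x \<sigma> \<phi> (Suc j) v) s + K * v s"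
proof -
  \<comment> \<open>The only lattice differences that occur: two steps \<open>A\<close>, \<open>B\<close> of \<open>x\<^bsub>-(j+1)\<^esub>\<close> and the step
    \<open>E\<close> between their midpoints \<open>X'\<close> and \<open>X\<close>, at which the affine function \<open>\<tau>\<^sub>j\<close> is evaluated.\<close>
  define A where "A = fdiff (xshift x (- int (Suc j))) s"
  define B where "B = fdiff (xshift x (- int (Suc j))) (s - 1)"
  define E where "E = fdiff (xshift x (- int (Suc j) - 1)) s"
  define X where "X = x (s - of_nat j / 2)"
  define X' where "X' = x (s - 1 - of_nat j / 2)"
  have nz: "A \<noteq> 0" "B \<noteq> 0" "E \<noteq> 0"
    using s fdiff_nz by (simp_all add: A_def B_def E_def)
  have bd: "bdiff (xshift x (- int j)) s = E" "bdiff (xshift x (- int (Suc j))) s = B"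
    "bdiff (xshift x (- int (Suc j))) (s + 1) = A"
    "bdiff (xshift x (int j + 1)) (s - of_nat j) = A"
    "bdiff (xshift x (int j + 1)) (s - 1 - of_nat j) = B"
    "xshift x (int j) (s - of_nat j) = X" "xshift x (int j) (s - 1 - of_nat j) = X'"
    by (simp_all add: bdiff_def fdiff_def xshift_def A_def B_def E_def X_def X'_def field_simps)
  have E: "E = X - X'"
    by (simp add: fdiff_def xshift_def E_def X_def X'_def field_simps)
  have 1: "\<phi> s = \<sigma> (s - of_nat j) + (K * X + L) * A"
    using K[of "s - of_nat j"] s unfolding bd by (simp add: diff_eq_eq add.commute)
  have 2: "\<phi> (s - 1) = \<sigma> (s - 1 - of_nat j) + (K * X' + L) * B"
    using K[of "s - 1 - of_nat j"] s unfolding bd by (simp add: diff_eq_eq add.commute)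
  have args: "s + 1 - of_nat (Suc j) = s - of_nat j" "s - of_nat (Suc j) = s - 1 - of_nat j"
    by simp_all
  have "weighted_diff x \<sigma> \<phi> j (fquot x (- int (Suc j)) v) s
     = (\<sigma> (s - of_nat j) * ((v (s + 1) - v s) / A) - \<phi> (s - 1) * ((v s - v (s - 1)) / B)) / E"
    unfolding weighted_diff_def fquot_def A_def[symmetric] B_def[symmetric] bd by (simp add: fdiff_def)
  moreover have "fquot x (- int (Suc j) - 1) (weighted_diff x \<sigma> \<phi> (Suc j) v) s
     = ((\<sigma> (s - of_nat j) * v (s + 1) - \<phi> s * v s) / A
       - (\<sigma> (s - 1 - of_nat j) * v s - \<phi> (s - 1) * v (s - 1)) / B) / E"
    unfolding weighted_diff_def fquot_def E_def[symmetric]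
    unfolding fdiff_def[of _ s] bd args by simp
  moreover have "(\<sigma> (s - of_nat j) * ((v (s + 1) - v s) / A) - \<phi> (s - 1) * ((v s - v (s - 1)) / B)) / E
     = ((\<sigma> (s - of_nat j) * v (s + 1) - \<phi> s * v s) / A
       - (\<sigma> (s - 1 - of_nat j) * v s - \<phi> (s - 1) * v (s - 1)) / B) / E + K * v s"
  proof -
    have "(K * X + L) * v s - (K * X' + L) * v s = E * (K * v s)"
      by (simp add: E algebra_simps)
    then show ?thesis
      unfolding 1 2 using nz by (simp add: divide_simps) (simp add: algebra_simps)
  qed
  ultimately show ?thesis by simp
qed

text \<open>
Moving \<open>M\<^sub>0\<close> inwards through \<open>\<Delta>\<^bsub>-1\<^esub> \<dots> \<Delta>\<^bsub>-n\<^esub>\<close> (with \<open>n = m + 1\<close>) turns it into \<open>M\<^sub>n\<close> and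
produces no terms besides multiples of \<open>\<Delta>\<^bsub>-2\<^esub> \<dots> \<Delta>\<^bsub>-n\<^esub> v\<close>: each step contributes one of the constants
\<open>K j\<close>. One difference less is applied here than in the equation for \<open>v\<close>; this stronger form also
determines the degree of \<open>M\<^sub>n v\<close> for \<open>v\<close> in the kernel.
\<close>

lemma weighted_diff_fquot_iter:
  assumes K: "\<And>j s. s \<in> grid N \<Longrightarrow>
      \<phi> (s + of_nat j) - \<sigma> s = (K j * xshift x (int j) s + L j) * bdiff (xshift x (int j + 1)) s"
    and s: "s \<in> grid N"
  shows "weighted_diff x \<sigma> \<phi> 0 (fquot_iter x (- int (Suc m)) (Suc m) v) s
    = fquot_iter x (- int (Suc m) - 1) (Suc m) (weighted_diff x \<sigma> \<phi> (Suc m) v) s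
      + (\<Sum>j\<le>m. K j) * fquot_iter x (- int (Suc m)) m v s"
  using s
proof (induction m arbitrary: v s)
  case 0
  then show ?case using weighted_diff_fquot[OF K, of s 0 v] by simp
next
  case (Suc m)
  let ?k = "- int (Suc m)"
  have k: "- int (Suc (Suc m)) = ?k - 1" by simp
  define v' where "v' = fquot x (?k - 1) v"
  have comm: "weighted_diff x \<sigma> \<phi> (Suc m) v' t
      = 1 * fquot x (?k - 1 - 1) (weighted_diff x \<sigma> \<phi> (Suc (Suc m)) v) t + K (Suc m) * v t"
    if "t \<in> grid N" for t
    using weighted_diff_fquot[OF K that, of "Suc m" v] unfolding v'_def k by simp
  have inner: "fquot_iter x (k - 1) (Suc i) f = fquot_iter x k i (fquot x (k - 1) f)" for k i f
    using fquot_iter_Suc_inner[of x "k - 1" i f] by simp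
  have "weighted_diff x \<sigma> \<phi> 0 (fquot_iter x (?k - 1) (Suc (Suc m)) v) s
      = weighted_diff x \<sigma> \<phi> 0 (fquot_iter x ?k (Suc m) v') s"
    unfolding inner v'_def ..
  also have "\<dots> = fquot_iter x (?k - 1) (Suc m) (weighted_diff x \<sigma> \<phi> (Suc m) v') s
      + (\<Sum>j\<le>m. K j) * fquot_iter x ?k m v' s"
    by (rule Suc.IH[OF Suc.prems])
  also have "fquot_iter x ?k m v' s = fquot_iter x (?k - 1) (Suc m) v s"
    unfolding inner v'_def ..
  also have "fquot_iter x (?k - 1) (Suc m) (weighted_diff x \<sigma> \<phi> (Suc m) v') s
      = fquot_iter x (?k - 1) (Suc m) (fquot x (?k - 1 - 1) (weighted_diff x \<sigma> \<phi> (Suc (Suc m)) v)) s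
        + K (Suc m) * fquot_iter x (?k - 1) (Suc m) v s"
    using fquot_iter_cong[OF comm Suc.prems, where x = x and k = "?k - 1" and m = "Suc m"]
    unfolding fquot_iter_linear by (simp del: fquot_iter.simps)
  also have "fquot_iter x (?k - 1) (Suc m) (fquot x (?k - 1 - 1) (weighted_diff x \<sigma> \<phi> (Suc (Suc m)) v)) s
      = fquot_iter x (?k - 1 - 1) (Suc (Suc m)) (weighted_diff x \<sigma> \<phi> (Suc (Suc m)) v) s"
    unfolding inner ..
  finally show ?case unfolding k by (simp add: algebra_simps del: fquot_iter.simps)
qed

end

section \<open>The adjoint equation and its general solution\<close>

lemma pearson_iff_sigma_dual:
  assumes "fdiff (xshift x (-1)) s \<noteq> 0"
  shows "fquot x (-1) (\<lambda>t. sigma_fun x St Tt t * \<rho> t) s = tau_fun x Tt s * \<rho> s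
    \<longleftrightarrow> sigma_fun x St Tt (s + 1) * \<rho> (s + 1) = sigma_dual x St Tt s * \<rho> s"
proof -
  define D where "D = fdiff (xshift x (-1)) s"
  have D: "bdiff (xshift x 1) s = D" "D \<noteq> 0"
    using bdiff_xshift[of x "-1" s] assms by (simp_all add: D_def)
  show ?thesis
    unfolding sigma_dual_eq fquot_def D_def[symmetric] D(1)
      fdiff_def[of "\<lambda>t. sigma_fun x St Tt t * \<rho> t"]
    using D(2) by (simp add: field_simps)
qed

lemma prod_backward_split_first:
  fixes \<sigma> :: "complex \<Rightarrow> complex"
  shows "(\<Prod>j=0..n. \<sigma> (s - of_nat j)) = \<sigma> s * (\<Prod>j<n. \<sigma> (s - 1 - of_nat j))"
  unfolding atLeast0AtMost lessThan_Suc_atMost[symmetric]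
  by (simp add: prod.lessThan_Suc_shift algebra_simps del: prod.lessThan_Suc)

text \<open>
The data of the equation reduced to what the argument uses: \<open>\<phi>\<close> stands for
\<open>\<sigma> + \<tau> \<nabla>x\<^sub>1\<close>, and \<open>K j\<close>, \<open>L j\<close> are slope and intercept of \<open>\<tau>\<^sub>j\<close> as a function of \<open>x\<^sub>j\<close>.
\<close>

locale hypergeometric_equation = lattice_grid +
  fixes \<rho> \<sigma> \<phi> :: "complex \<Rightarrow> complex" and K L :: "nat \<Rightarrow> complex"
  assumes pearson: "s \<in> grid N \<Longrightarrow> \<sigma> (s + 1) * \<rho> (s + 1) = \<phi> s * \<rho> s"
    and dual_difference: "s \<in> grid N \<Longrightarrow>
      \<phi> (s + of_nat j) - \<sigma> s = (K j * xshift x (int j) s + L j) * bdiff (xshift x (int j + 1)) s"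
    and sigma_nz: "s \<in> grid N \<Longrightarrow> \<sigma> s \<noteq> 0"
    and rho_nz: "s \<in> grid N \<Longrightarrow> \<rho> s \<noteq> 0"
begin

text \<open>
Multiplied by \<open>\<rho>\<close>, the equation becomes \<open>\<Delta>\<^bsub>-1\<^esub>[\<sigma> \<rho> \<nabla>\<^sub>0 y] + \<lambda> \<rho> y = 0\<close>, and Pearson's equation
expresses \<open>\<sigma> \<rho> \<nabla>\<^sub>0 y\<close> through \<open>w = \<rho> y\<close> as \<open>M\<^sub>0 w\<close>. Here \<open>a\<close> and \<open>b\<close> are the values of the two
polynomial coefficients at \<open>s\<close>.
\<close>

lemma self_adjoint_form:
  assumes s: "s \<in> grid N"
    and \<sigma>: "\<sigma> s = a - b / 2 * fdiff (xshift x (-1)) s"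
    and \<phi>: "\<phi> s = a + b / 2 * fdiff (xshift x (-1)) s"
  shows "\<rho> s * (a * fquot x (-1) (bquot x 0 y) s + b / 2 * (fquot x 0 y s + bquot x 0 y s) + lam * y s)
    = fquot x (-1) (weighted_diff x \<sigma> \<phi> 0 (\<lambda>t. \<rho> t * y t)) s + lam * (\<rho> s * y s)"
proof -
  define D where "D = fdiff (xshift x (-1)) s"
  have D: "D \<noteq> 0" using fdiff_nz[OF s] by (simp add: D_def)
  define F where "F = fquot x 0 y s"
  define B where "B = bquot x 0 y s"
  have weighted: "weighted_diff x \<sigma> \<phi> 0 (\<lambda>t. \<rho> t * y t) t = \<sigma> t * \<rho> t * bquot x 0 y t"
    if "t \<in> grid N" for t
    using pearson[of "t - 1"] that
    by (simp add: weighted_diff_def bquot_def bdiff_def[of y] algebra_simps)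
  have FB: "bquot x 0 y (s + 1) = F" by (simp add: F_def bquot_shift)
  have adj: "fquot x (-1) (weighted_diff x \<sigma> \<phi> 0 (\<lambda>t. \<rho> t * y t)) s = (\<phi> s * \<rho> s * F - \<sigma> s * \<rho> s * B) / D"
    using weighted[OF s] weighted[of "s + 1"] s pearson[OF s]
    by (simp add: fquot_def fdiff_def[of "weighted_diff _ _ _ _ _"] FB flip: D_def B_def)
  have second: "fquot x (-1) (bquot x 0 y) s = (F - B) / D"
    by (simp add: fquot_def fdiff_def[of "bquot _ _ _"] FB flip: D_def B_def)
  show ?thesis
    unfolding adj second \<sigma> \<phi> D_def[symmetric] F_def[symmetric] B_def[symmetric]
    using D by (simp add: field_simps)
qed

definition rodrigues_weight :: "nat \<Rightarrow> complex \<Rightarrow> complex" where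
  "rodrigues_weight n s = \<rho> s * (\<Prod>j=0..n - 1. \<sigma> (s - of_nat j))"

lemma rodrigues_weight_nz: "s \<in> grid N \<Longrightarrow> rodrigues_weight n s \<noteq> 0"
  by (simp add: rodrigues_weight_def rho_nz sigma_nz)

text \<open>
The Rodrigues weight is an integrating factor of \<open>M\<^sub>n\<close>: by Pearson's equation
\<open>\<phi>(s-1) R(s-1) = \<sigma>(s-n) R(s)\<close>, where \<open>R\<close> is the weight. Hence \<open>M\<^sub>n v = P\<close> is solved by one
summation.
\<close>

lemma weighted_diff_rodrigues_weight:
  assumes s: "s \<in> grid N" and n: "n \<ge> 1"
  shows "weighted_diff x \<sigma> \<phi> n (\<lambda>t. rodrigues_weight n t * z t) s
    = \<rho> s * (\<Prod>j=0..n. \<sigma> (s - of_nat j)) * bquot x (- int n) z s"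
proof -
  define W where "W = \<rho> s * (\<Prod>j=0..n. \<sigma> (s - of_nat j))"
  obtain m where m: "n = Suc m" using n by (cases n) auto
  have "\<sigma> (s - of_nat n) * rodrigues_weight n s = W"
    by (simp add: rodrigues_weight_def W_def m)
  moreover have "\<phi> (s - 1) * rodrigues_weight n (s - 1) = W"
  proof -
    have "\<phi> (s - 1) * \<rho> (s - 1) = \<sigma> s * \<rho> s"
      using pearson[of "s - 1"] s by simp
    then have "\<phi> (s - 1) * rodrigues_weight n (s - 1)
        = \<sigma> s * \<rho> s * (\<Prod>j=0..m. \<sigma> (s - 1 - of_nat j))"
      by (simp add: rodrigues_weight_def m)
    also have "\<dots> = W"
      unfolding W_def prod_backward_split_first[of \<sigma> s n] by (simp add: m lessThan_Suc_atMost atLeast0AtMost)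
    finally show ?thesis .
  qed
  ultimately show ?thesis
    unfolding W_def[symmetric]
    by (simp add: weighted_diff_def bquot_def bdiff_def[of z] right_diff_distrib mult.assoc[symmetric])
qed

text \<open>
For \<open>\<lambda> = \<lambda>\<^sub>n\<close>, which is minus the sum of the \<open>K j\<close>, the zeroth order term cancels against the
constants produced by commuting, and the second order operator applied to \<open>\<Delta>\<^bsub>-n\<^esub>\<^bsup>(n)\<^esup> v\<close> is an
iterated difference quotient of the first order expression \<open>M\<^sub>n v\<close>.
\<close>

lemma adjoint_factorization:
  assumes s: "s \<in> grid N" and n: "n \<ge> 1"
    and w: "\<And>s. s \<in> grid N \<Longrightarrow> w s = fquot_iter x (- int n) n v s"
  shows "fquot x (-1) (weighted_diff x \<sigma> \<phi> 0 w) s - (\<Sum>j<n. K j) * w s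
    = fquot_iter x (- int n - 1) (Suc n) (weighted_diff x \<sigma> \<phi> n v) s"
proof -
  obtain m where m: "n = Suc m" using n by (cases n) auto
  define S where "S = (\<Sum>j<n. K j)"
  define f where "f = fquot_iter x (- int n) m v"
  define g where "g = fquot_iter x (- int n - 1) n (weighted_diff x \<sigma> \<phi> n v)"
  have comm: "weighted_diff x \<sigma> \<phi> 0 w t = g t + S * f t" if "t \<in> grid N" for t
    using weighted_diff_cong[of N w "fquot_iter x (- int n) n v" t x \<sigma> \<phi> 0, OF w that]
      weighted_diff_fquot_iter[where \<phi> = \<phi> and \<sigma> = \<sigma> and L = L and K = K and m = m and v = v and s = t,
        OF dual_difference that]
    by (simp add: S_def f_def g_def m lessThan_Suc_atMost del: fquot_iter.simps)
  have "fquot x (-1) (weighted_diff x \<sigma> \<phi> 0 w) s = fquot x (-1) (\<lambda>t. g t + S * f t) s"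
    by (rule fquot_cong[OF comm s])
  also have "\<dots> = fquot x (-1) g s + S * fquot x (-1) f s"
    by (simp add: fquot_def fdiff_def add_divide_distrib diff_divide_distrib algebra_simps)
  also have "fquot x (-1) f s = w s"
    using w[OF s] by (simp add: f_def m)
  also have "fquot x (-1) g s = fquot_iter x (- int n - 1) (Suc n) (weighted_diff x \<sigma> \<phi> n v) s"
    by (simp add: g_def)
  finally show ?thesis by (simp add: S_def)
qed

text \<open>
Choose \<open>v\<close> with \<open>\<Delta>\<^bsub>-2\<^esub> \<dots> \<Delta>\<^bsub>-n\<^esub> v = 1\<close>. One more difference kills \<open>v\<close>, and the commutation rule
shows that \<open>n\<close> difference quotients reduce \<open>M\<^sub>n v\<close> to the constant \<open>\<lambda>\<^sub>n\<close>. As \<open>\<lambda>\<^sub>n \<noteq> 0\<close>,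
\<open>M\<^sub>n v\<close> is a polynomial of degree \<open>n\<close> and no less; no leading coefficient has to be computed.
\<close>

lemma kernel_element_of_full_degree:
  assumes q: "\<And>d. 0 < d \<Longrightarrow> d \<le> n \<Longrightarrow> q_number \<alpha> d \<noteq> 0"
    and n: "n \<ge> 1" and S: "(\<Sum>j<n. K j) \<noteq> 0"
  obtains v Q where "\<And>s. s \<in> grid N \<Longrightarrow> fquot_iter x (- int n) n v s = 0"
    and "\<And>s. s \<in> grid N \<Longrightarrow> weighted_diff x \<sigma> \<phi> n v s = poly Q (xshift x (- int n - 1) s)"
    and "degree Q = n"
proof -
  obtain m where m: "n = Suc m" using n by (cases n) auto
  obtain v where v: "\<And>s. s \<in> grid N \<Longrightarrow> fquot_iter x (- int n) m v s = 1"
    using fquot_iter_antiderivative[where g = "\<lambda>_. 1"] by blast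
  have v0: "fquot_iter x (- int n) n v s = 0" if "s \<in> grid N" for s
    using that v by (simp add: m fquot_def fdiff_def)
  have "fquot_iter x (- int n - 1) n (weighted_diff x \<sigma> \<phi> n v) s = - (\<Sum>j<n. K j)"
    if s: "s \<in> grid N" for s
  proof -
    have "weighted_diff x \<sigma> \<phi> 0 (fquot_iter x (- int n) n v) s = 0"
      using s v0 by (simp add: weighted_diff_def)
    then show ?thesis
      using weighted_diff_fquot_iter[where \<phi> = \<phi> and \<sigma> = \<sigma> and L = L and K = K and m = m and v = v,
          OF dual_difference s] v[OF s]
      by (simp add: m lessThan_Suc_atMost add_eq_0_iff del: fquot_iter.simps)
  qed
  note image = this
  have "fquot_iter x (- int n - 1) (Suc n) (weighted_diff x \<sigma> \<phi> n v) s = 0" if "s \<in> grid N" for s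
    using that image by (simp add: fquot_def fdiff_def)
  then obtain Q where Q: "\<And>i. i \<ge> Suc n \<Longrightarrow> coeff Q i = 0"
    and vQ: "\<And>s. s \<in> grid N \<Longrightarrow> weighted_diff x \<sigma> \<phi> n v s = poly Q (xshift x (- int n - 1) s)"
    using fquot_iter_eq_0_imp_poly[of "Suc n" "- int n - 1" "weighted_diff x \<sigma> \<phi> n v"] q
    by (metis less_Suc_eq_le)
  have "coeff Q n \<noteq> 0"
  proof
    assume "coeff Q n = 0"
    then have low: "coeff Q i = 0" if "i \<ge> n" for i
      using that Q[of i] by (cases "i = n") auto
    have N: "N \<in> grid N" by (rule grid_base)
    have "fquot_iter x (- int n - 1) n (weighted_diff x \<sigma> \<phi> n v) N = 0"
      using fquot_iter_cong[OF vQ N] fquot_iter_poly_eq_0[OF low N] by simp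
    with image[OF N] S show False by simp
  qed
  moreover have "degree Q \<le> n" using Q by (simp add: degree_le)
  ultimately have "degree Q = n" using le_degree by (metis le_antisym)
  with that v0 vQ show thesis by blast
qed

text \<open>
Any \<open>n\<close>-fold antiderivative \<open>v\<^sub>0\<close> of \<open>w\<close> makes \<open>M\<^sub>n v\<^sub>0\<close> a polynomial of degree at most \<open>n\<close>, but the
degree may drop. Adding a multiple of a kernel element whose image has full degree leaves \<open>w\<close>
unchanged and normalises the coefficient of degree \<open>n\<close> to \<open>1\<close>.
\<close>

lemma kernel_correction:
  assumes q: "\<And>d. 0 < d \<Longrightarrow> d \<le> n \<Longrightarrow> q_number \<alpha> d \<noteq> 0"
    and n: "n \<ge> 1" and S: "(\<Sum>j<n. K j) \<noteq> 0"
    and w: "\<And>s. s \<in> grid N \<Longrightarrow>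
      fquot x (-1) (weighted_diff x \<sigma> \<phi> 0 w) s - (\<Sum>j<n. K j) * w s = 0"
  obtains v P where "\<And>s. s \<in> grid N \<Longrightarrow> w s = fquot_iter x (- int n) n v s"
    and "\<And>s. s \<in> grid N \<Longrightarrow> weighted_diff x \<sigma> \<phi> n v s = poly P (xshift x (- int n - 1) s)"
    and "degree P = n"
proof -
  obtain v0 where v0: "\<And>s. s \<in> grid N \<Longrightarrow> fquot_iter x (- int n) n v0 s = w s"
    using fquot_iter_antiderivative by blast
  have "fquot_iter x (- int n - 1) (Suc n) (weighted_diff x \<sigma> \<phi> n v0) s = 0" if "s \<in> grid N" for s
    using adjoint_factorization[of s n w v0, OF that n v0[symmetric]] w[OF that] by simp
  then obtain Q0 where Q0: "\<And>i. i \<ge> Suc n \<Longrightarrow> coeff Q0 i = 0"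
    and vQ0: "\<And>s. s \<in> grid N \<Longrightarrow> weighted_diff x \<sigma> \<phi> n v0 s = poly Q0 (xshift x (- int n - 1) s)"
    using fquot_iter_eq_0_imp_poly[of "Suc n" "- int n - 1" "weighted_diff x \<sigma> \<phi> n v0"] q
    by (metis less_Suc_eq_le)
  obtain v1 Q1 where v1: "\<And>s. s \<in> grid N \<Longrightarrow> fquot_iter x (- int n) n v1 s = 0"
    and vQ1: "\<And>s. s \<in> grid N \<Longrightarrow> weighted_diff x \<sigma> \<phi> n v1 s = poly Q1 (xshift x (- int n - 1) s)"
    and Q1: "degree Q1 = n"
    using kernel_element_of_full_degree[OF q n S] by blast
  have lead1: "coeff Q1 n \<noteq> 0" using Q1 n by (metis degree_0 leading_coeff_0_iff not_one_le_zero)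
  define c where "c = (1 - coeff Q0 n) / coeff Q1 n"
  define P where "P = Q0 + smult c Q1"
  define v where "v = (\<lambda>t. 1 * v0 t + c * v1 t)"
  have "coeff P n = 1" using lead1 by (simp add: P_def c_def)
  moreover have "degree P \<le> n"
    unfolding P_def using Q0 Q1 by (intro degree_add_le) (auto intro: degree_le)
  ultimately have "degree P = n" using le_degree[of P n] by simp
  show thesis
  proof (rule that[of v P])
    fix s assume s: "s \<in> grid N"
    show "w s = fquot_iter x (- int n) n v s"
      unfolding v_def fquot_iter_linear using v0[OF s] v1[OF s] by simp
    show "weighted_diff x \<sigma> \<phi> n v s = poly P (xshift x (- int n - 1) s)"
      unfolding v_def weighted_diff_linear using vQ0[OF s] vQ1[OF s] by (simp add: P_def)
  qed fact
qed

text \<open>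
Solving \<open>M\<^sub>n v = P\<close> with the integrating factor: \<open>v\<close> is the Rodrigues weight times
\<open>C\<close> plus the discrete integral, and \<open>C\<close> is the value at \<open>N - 1\<close>, where the integral vanishes.
\<close>

lemma adjoint_general_solution:
  assumes q: "\<And>d. 0 < d \<Longrightarrow> d \<le> n \<Longrightarrow> q_number \<alpha> d \<noteq> 0"
    and n: "n \<ge> 1" and S: "(\<Sum>j<n. K j) \<noteq> 0"
  shows "(\<forall>s\<in>grid N. fquot x (-1) (weighted_diff x \<sigma> \<phi> 0 w) s - (\<Sum>j<n. K j) * w s = 0)
    \<longleftrightarrow> (\<exists>C P. degree P = n \<and>
      (\<forall>s\<in>grid N. w s = C * fquot_iter x (- int n) n (rodrigues_weight n) s
        + fquot_iter x (- int n) n (\<lambda>t. rodrigues_weight n t * nabla_integral x (- int n) N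
            (\<lambda>t. poly P (xshift x (- (int n + 1)) t) / (\<rho> t * (\<Prod>j=0..n. \<sigma> (t - of_nat j)))) t) s))"
    (is "?solves \<longleftrightarrow> (\<exists>C P. degree P = n \<and> (\<forall>s\<in>grid N. w s = ?y C P s))")
proof -
  let ?g = "\<lambda>P t. poly P (xshift x (- (int n + 1)) t) / (\<rho> t * (\<Prod>j=0..n. \<sigma> (t - of_nat j)))"
  have denom_nz: "\<rho> t * (\<Prod>j=0..n. \<sigma> (t - of_nat j)) \<noteq> 0" if "t \<in> grid N" for t
    using that by (simp add: rho_nz sigma_nz)
  have y_eq: "?y C P s = fquot_iter x (- int n) n
      (\<lambda>t. rodrigues_weight n t * (C + nabla_integral x (- int n) N (?g P) t)) s" for C P s
    using fquot_iter_linear[of x "- int n" n C "rodrigues_weight n" 1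
        "\<lambda>t. rodrigues_weight n t * nabla_integral x (- int n) N (?g P) t" s]
    by (simp add: algebra_simps)
  show ?thesis
  proof
    assume ?solves
    then obtain v P where wv: "\<And>s. s \<in> grid N \<Longrightarrow> w s = fquot_iter x (- int n) n v s"
      and vP: "\<And>s. s \<in> grid N \<Longrightarrow> weighted_diff x \<sigma> \<phi> n v s = poly P (xshift x (- int n - 1) s)"
      and P: "degree P = n"
      using kernel_correction[OF q n S, of w] by blast
    define z where "z = (\<lambda>t. v t / rodrigues_weight n t)"
    have v_eq: "v t = rodrigues_weight n t * z t" if "t \<in> grid N" for t
      using rodrigues_weight_nz[OF that] by (simp add: z_def)
    have "bquot x (- int n) z s = ?g P s" if "s \<in> grid N" for s
      using weighted_diff_cong[of N v _ s x \<sigma> \<phi> n, OF v_eq that] vP[OF that] denom_nz[OF that]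
        weighted_diff_rodrigues_weight[OF that n, of z]
      by (simp add: eq_divide_eq mult.commute)
    then have z_eq: "z s = z (N - 1) + nabla_integral x (- int n) N (?g P) s" if "s \<in> grid N" for s
      using bquot_eq_imp_nabla_integral[of "- int n" z "?g P" s] that by blast
    have "w s = ?y (z (N - 1)) P s" if s: "s \<in> grid N" for s
      unfolding y_eq wv[OF s]
      using s by (intro fquot_iter_cong[of N]) (simp_all only: v_eq z_eq[symmetric])
    with P show "\<exists>C P. degree P = n \<and> (\<forall>s\<in>grid N. w s = ?y C P s)" by blast
  next
    assume "\<exists>C P. degree P = n \<and> (\<forall>s\<in>grid N. w s = ?y C P s)"
    then obtain C P where P: "degree P = n" and w: "\<And>s. s \<in> grid N \<Longrightarrow> w s = ?y C P s" by blast
    define z where "z = (\<lambda>t. C + nabla_integral x (- int n) N (?g P) t)"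
    have z: "bquot x (- int n) z s = ?g P s" if "s \<in> grid N" for s
      using bquot_nabla_integral[OF that bdiff_nz[OF that, of "- int n"], of "?g P"]
      by (simp add: z_def bquot_def bdiff_def)
    have vP: "weighted_diff x \<sigma> \<phi> n (\<lambda>t. rodrigues_weight n t * z t) s = poly P (xshift x (- int n - 1) s)"
      if "s \<in> grid N" for s
      unfolding weighted_diff_rodrigues_weight[OF that n] z[OF that]
      using denom_nz[OF that] by simp
    show ?solves
    proof
      fix s assume s: "s \<in> grid N"
      have "fquot x (-1) (weighted_diff x \<sigma> \<phi> 0 w) s - (\<Sum>j<n. K j) * w s
          = fquot_iter x (- int n - 1) (Suc n) (weighted_diff x \<sigma> \<phi> n (\<lambda>t. rodrigues_weight n t * z t)) s"
        by (rule adjoint_factorization[OF s n]) (simp only: w y_eq z_def)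
      also have "\<dots> = fquot_iter x (- int n - 1) (Suc n) (\<lambda>t. poly P (xshift x (- int n - 1) t)) s"
        by (rule fquot_iter_cong[OF vP s])
      also have "\<dots> = 0"
        by (rule fquot_iter_poly_eq_0[OF _ s]) (simp add: P coeff_eq_0)
      finally show "fquot x (-1) (weighted_diff x \<sigma> \<phi> 0 w) s - (\<Sum>j<n. K j) * w s = 0" .
    qed
  qed
qed

end

theorem theorem7p1:
  fixes x \<rho> \<sigma> \<tau> y :: "complex \<Rightarrow> complex"
    and St Tt :: "complex poly"
    and lam N :: complex
    and n :: nat
  assumes lattice: "nonuniform_lattice x"
    and n_pos: "n \<ge> 1"
    and deg_St: "degree St \<le> 2"
    and deg_Tt: "degree Tt \<le> 1"
    and sigma: "\<sigma> = sigma_fun x St Tt"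
    and tau: "\<tau> = tau_fun x Tt"
    and pearson: "\<And>s. s \<in> grid N \<Longrightarrow> fquot x (-1) (\<lambda>t. \<sigma> t * \<rho> t) s = \<tau> s * \<rho> s"
    and lattice_nz: "\<And>s (k::int). s \<in> grid N \<Longrightarrow> fdiff (xshift x k) s \<noteq> 0"
    and sigma_nz: "\<And>s. s \<in> grid N \<Longrightarrow> \<sigma> s \<noteq> 0"
    and rho_nz: "\<And>s. s \<in> grid N \<Longrightarrow> \<rho> s \<noteq> 0"
    and eigen: "lam = eigenval x St Tt N n"
    and eigen_distinct: "\<And>m. m < n \<Longrightarrow> eigenval x St Tt N m \<noteq> eigenval x St Tt N n"
  shows
    "(\<forall>s\<in>grid N.
        poly St (x s) * fquot x (-1) (bquot x 0 y) s
          + poly Tt (x s) / 2 * (fquot x 0 y s + bquot x 0 y s) + lam * y s = 0)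
     \<longleftrightarrow>
     (\<exists>C P. degree P = n \<and>
        (\<forall>s\<in>grid N.
           y s =
             C / \<rho> s * fquot_iter x (- int n) n (\<lambda>s. \<rho> s * (\<Prod>j=0..n-1. \<sigma> (s - of_nat j))) s
             + 1 / \<rho> s * fquot_iter x (- int n) n
                 (\<lambda>s. \<rho> s * (\<Prod>j=0..n-1. \<sigma> (s - of_nat j))
                    * nabla_integral x (- int n) N
                        (\<lambda>t. poly P (xshift x (- (int n + 1)) t)
                             / (\<rho> t * (\<Prod>j=0..n. \<sigma> (t - of_nat j)))) s) s))"
proof -
  obtain \<alpha> \<beta> \<gamma> \<delta> K L where
    sum: "\<And>u. x (u + 1/2) + x (u - 1/2) = 2 * \<alpha> * x u + \<beta>" and
    prod: "\<And>u. x (u + 1/2) * x (u - 1/2) = (x u)\<^sup>2 + \<gamma> * x u + \<delta>" and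
    K: "\<And>j s. sigma_dual x St Tt (s + of_nat j) - sigma_fun x St Tt s =
      (K j * xshift x (int j) s + L j) * bdiff (xshift x (int j + 1)) s" and
    period: "\<And>d m. d > 0 \<Longrightarrow> q_number \<alpha> d = 0 \<Longrightarrow> (\<Sum>j<m + d. K j) = (\<Sum>j<m. K j)"
    using nonuniform_lattice_structure[OF lattice deg_St deg_Tt] by blast
  interpret lattice_grid x N \<alpha> \<beta> \<gamma> \<delta>
    using lattice_nz sum prod by unfold_locales
  interpret hypergeometric_equation x N \<alpha> \<beta> \<gamma> \<delta> \<rho> \<sigma> "sigma_dual x St Tt" K L
    using pearson sigma_nz rho_nz K fdiff_nz
    by unfold_locales (simp_all add: sigma tau pearson_iff_sigma_dual)
  have N: "N \<in> grid N" by (rule grid_base)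
  have eigenval: "eigenval x St Tt N m = - (\<Sum>j<m. K j)" for m
  proof -
    have "tau_shift x St Tt j s = K j * xshift x (int j) s + L j" if "s \<in> grid N" for j s
      using K[of s j] bdiff_nz[OF that, of "int j + 1"]
      by (simp add: tau_shift_def sigma_dual_eq diff_add_eq)
    then have "fquot x (int j) (tau_shift x St Tt j) N = K j" for j
      using N fdiff_nz[OF N, of "int j"]
      by (simp add: fquot_def fdiff_def[of "tau_shift _ _ _ _"] flip: right_diff_distrib)
        (simp add: fdiff_def)
    then show ?thesis by (simp add: eigenval_def)
  qed
  have lam: "lam = - (\<Sum>j<n. K j)" by (simp add: eigen eigenval)
  have S: "(\<Sum>j<n. K j) \<noteq> 0"
    using eigen_distinct[of 0] n_pos by (auto simp: eigenval)
  \<comment> \<open>If \<open>[d] = 0\<close>, the eigenvalues repeat with period \<open>d\<close>, so \<open>\<lambda>\<^bsub>n-d\<^esub> = \<lambda>\<^sub>n\<close>.\<close>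
  have q: "q_number \<alpha> d \<noteq> 0" if "0 < d" "d \<le> n" for d
    using period[of d "n - d"] eigen_distinct[of "n - d"] that by (auto simp: eigenval)
  have equation: "poly St (x s) * fquot x (-1) (bquot x 0 y) s
          + poly Tt (x s) / 2 * (fquot x 0 y s + bquot x 0 y s) + lam * y s = 0
      \<longleftrightarrow> fquot x (-1) (weighted_diff x \<sigma> (sigma_dual x St Tt) 0 (\<lambda>t. \<rho> t * y t)) s
        - (\<Sum>j<n. K j) * (\<rho> s * y s) = 0"
    (is "?E = 0 \<longleftrightarrow> ?F = 0") if s: "s \<in> grid N" for s
  proof -
    have "bdiff (xshift x 1) s = fdiff (xshift x (-1)) s"
      using bdiff_xshift[of x "-1" s] by simp
    then have "\<sigma> s = poly St (x s) - poly Tt (x s) / 2 * fdiff (xshift x (-1)) s"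
      and "sigma_dual x St Tt s = poly St (x s) + poly Tt (x s) / 2 * fdiff (xshift x (-1)) s"
      by (simp_all add: sigma sigma_fun_def sigma_dual_def)
    from self_adjoint_form[OF s this, of y lam] have F: "?F = \<rho> s * ?E"
      unfolding lam by (simp only: mult_minus_left add_uminus_conv_diff)
    show ?thesis
      unfolding F mult_eq_0_iff using rho_nz[OF s] by simp
  qed
  have solution: "(y s = C / \<rho> s * A + 1 / \<rho> s * B) \<longleftrightarrow> \<rho> s * y s = C * A + B"
    if "s \<in> grid N" for s C A B
    using rho_nz[OF that] by (auto simp: field_simps)
  have weight: "rodrigues_weight n = (\<lambda>s. \<rho> s * (\<Prod>j=0..n-1. \<sigma> (s - of_nat j)))"
    by (simp add: rodrigues_weight_def fun_eq_iff)
  show ?thesis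
    using adjoint_general_solution[OF q n_pos S, of "\<lambda>t. \<rho> t * y t"]
    by (simp only: equation solution weight cong: ball_cong)
qed

end
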